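(* If $f\in L^1(\mathbb{R})\cap L^2(\mathbb{R})$ is nonnegative and supported on an interval of length $I$, and $h$ is an even positive integer, then $$\|f^{\ast h}\|_\infty > \frac{1.262}{hI}\,\|f\|_1^h .$$
   Context: For a function $f$ on $\mathbb{R}$, the autoconvolution is $f^{\ast 2}(x)=f\ast f(x):=\int_{\mathbb{R}} f(y)f(x-y)\,dy$, and for integers $h>2$ the $h$-fold autoconvolution is defined recursively by $f^{\ast h}:=f^{\ast(h-1)}\ast f$. The norms $\|\cdot\|_1$ and $\|\cdot\|_\infty$ are the usual $L^1(\mathbb{R})$ and $L^\infty(\mathbb{R})$ norms.
   Formalization: The function f is additionally assumed not to vanish almost everywhere, since for f = 0 the strict inequality would read 0 > 0. *)

theory Defs
  imports "HOL-Probability.Essential_Supremum"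
begin

definition convolution :: "(real \<Rightarrow> real) \<Rightarrow> (real \<Rightarrow> real) \<Rightarrow> real \<Rightarrow> real" where
  "convolution f g x = (LINT y|lebesgue. f y * g (x - y))"

(* The 0-fold autoconvolution has no meaning; its value is a placeholder. *)
fun autoconvolution :: "nat \<Rightarrow> (real \<Rightarrow> real) \<Rightarrow> real \<Rightarrow> real" where
  "autoconvolution 0 f = (\<lambda>x. 0)"
| "autoconvolution (Suc 0) f = f"
| "autoconvolution (Suc (Suc n)) f = convolution (autoconvolution (Suc n) f) f"

(* The Bochner integral is 0 off L^1, so this is the norm only for integrable f. *)
definition L1_norm :: "(real \<Rightarrow> real) \<Rightarrow> real" where
  "L1_norm f = (LINT x|lebesgue. \<bar>f x\<bar>)"

(* Extended-real valued: essentially unbounded (and, by the convention of esssup,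
   non-measurable) functions have norm infinity. *)
definition Linf_norm :: "(real \<Rightarrow> real) \<Rightarrow> ereal" where
  "Linf_norm f = esssup lebesgue (\<lambda>x. ereal \<bar>f x\<bar>)"

end

theory Submission
  imports Defs "HOL-Probability.Probability_Measure"
begin

text \<open>Since \<open>f\<^sup>*\<^sup>h = G * G\<close> for the \<open>h/2\<close>-fold autoconvolution \<open>G\<close> of \<open>f\<close>, which lives on an interval of
  length \<open>hI/2\<close>, it suffices to treat \<open>h = 2\<close>; rescale so that \<open>f\<close> is a probability density on
  \<open>[-3\<pi>/4, 3\<pi>/4]\<close>. Let \<open>C = f * f\<close>, let \<open>D(z) = \<integral> f(y) f(y + z) dy\<close>, and suppose \<open>C \<le> M\<close>. Fix a nonnegative
  \<open>K(t) = \<Sum>\<^sub>j c\<^sub>j cos(jt)\<close> with all \<open>c\<^sub>j > 0\<close>, and put \<open>T = [-3\<pi>/2, 3\<pi>/2]\<close>, which carries \<open>C\<close> and \<open>D\<close>. Then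
  \<open>\<integral> C K \<le> M \<integral>\<^sub>T K\<close>, while \<open>\<integral> D\<^sup>2 = \<integral> C\<^sup>2 \<le> M\<close> bounds \<open>\<integral> D K\<close> by Cauchy-Schwarz. On the other hand
  \<open>\<integral> (C + D) K = 2 \<Sum>\<^sub>j c\<^sub>j a\<^sub>j\<^sup>2\<close> with \<open>a\<^sub>j = \<integral> f(x) cos(jx) dx\<close>, and this is bounded below because a second
  cosine polynomial \<open>\<Sum>\<^sub>j p\<^sub>j cos(jt)\<close>, with \<open>p\<^sub>0\<close> very negative, is nonnegative on \<open>[-3\<pi>/4, 3\<pi>/4]\<close>, so that
  \<open>\<Sum>\<^sub>j p\<^sub>j a\<^sub>j \<ge> 0\<close>. Together these force \<open>M > 2 \<cdot> 0.631 / (3\<pi>)\<close>. This is the method of Yu and of Martin and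
  O'Bryant, with \<open>K\<close> a cosine polynomial instead of a compactly supported kernel, so that no Fourier
  series are needed.\<close>

section \<open>The two cosine polynomials\<close>

text \<open>Chebyshev polynomials of the first kind: with y = cos t they turn cosine sums into
  polynomials in y, whose sign is certified by algebraic identities.\<close>

fun cheb_T :: "nat \<Rightarrow> real \<Rightarrow> real" where
  "cheb_T 0 y = 1"
| "cheb_T (Suc 0) y = y"
| "cheb_T (Suc (Suc n)) y = 2 * y * cheb_T (Suc n) y - cheb_T n y"

lemma cheb_T_cos: "cheb_T n (cos t) = cos (real n * t)"
proof (induction n "cos t" rule: cheb_T.induct)
  case (3 n)
  have "cos (real (Suc (Suc n)) * t) = cos (real (Suc n) * t + t)"
    "cos (real n * t) = cos (real (Suc n) * t - t)"
    by (simp_all add: algebra_simps)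
  then show ?case
    using 3 by (simp add: cos_add cos_diff)
qed simp_all

lemma cheb_T_numeral:
  "cheb_T 2 y = 2*y^2 - 1"
  "cheb_T 3 y = 4*y^3 - 3*y"
  "cheb_T 4 y = 8*y^4 - 8*y^2 + 1"
  "cheb_T 5 y = 16*y^5 - 20*y^3 + 5*y"
  "cheb_T 6 y = 32*y^6 - 48*y^4 + 18*y^2 - 1"
  "cheb_T 7 y = 64*y^7 - 112*y^5 + 56*y^3 - 7*y"
  "cheb_T 8 y = 128*y^8 - 256*y^6 + 160*y^4 - 32*y^2 + 1"
  "cheb_T 9 y = 256*y^9 - 576*y^7 + 432*y^5 - 120*y^3 + 9*y"
  "cheb_T 10 y = 512*y^10 - 1280*y^8 + 1120*y^6 - 400*y^4 + 50*y^2 - 1"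
  by (simp_all add: eval_nat_numeral algebra_simps)

text \<open>The coefficients of \<open>K\<close> and of the minorant are integer roundings, in the sum-of-squares forms of
  \<open>kernel_sos\<close> and \<open>minorant_sos\<close>, of a numerical solution of the convex problem of maximising the
  resulting bound on \<open>M\<close>.\<close>

definition kcoeff :: "nat \<Rightarrow> real" where
  "kcoeff j = [189/2, 143, 66, 27, 57/2, 27, 21/2, 6, 27/2, 17, 8] ! j"

definition pcoeff :: "nat \<Rightarrow> real" where
  "pcoeff j = [-3239/2, 12723/4, -5497/2, 4093/2, -1242, 2111/4, 22, -299, 392, -308, 144] ! j"

lemma sum_11: "(\<Sum>j<11. g j) = g 0 + g 1 + g 2 + g 3 + g 4 + g 5 + g 6 + g 7 + g 8 + g 9 + g (10::nat)"
  for g :: "nat \<Rightarrow> real"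
  by (simp add: eval_nat_numeral)

text \<open>The right side is visibly nonnegative for -1 \<le> y \<le> 1, the range of y = cos
  t.\<close>

lemma kernel_sos:
  "(\<Sum>j<11. kcoeff j * cheb_T j y) =
    (6 + 11*y - 52*y^2 - 80*y^3 + 56*y^4 + 80*y^5)^2 + 4 * (1 - y^2) * (2 + 11*y + 6*y^2 - 24*y^3 - 24*y^4)^2"
  unfolding sum_11 kcoeff_def by (simp add: cheb_T_numeral) algebra

text \<open>Visibly nonnegative for -17/24 \<le> y \<le> 1. Here -17/24 is a rational just below cos
  (3 pi / 4) = - sqrt 2 / 2.\<close>

lemma minorant_sos:
  "(\<Sum>j<11. pcoeff j * cheb_T j y) =
    96 * (1 - 4*y - 14*y^2 + 24*y^3 + 24*y^4 - 32*y^5)^2 + (1 - y) * (17 + 24*y) * (1 - 7*y - 2*y^2 + 40*y^3 - 32*y^4)^2"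
  unfolding sum_11 pcoeff_def by (simp add: cheb_T_numeral) algebra

definition cosint :: "int \<Rightarrow> real \<Rightarrow> real" where
  "cosint m t = (if m = 0 then t else sin (real_of_int m * t) / real_of_int m)"

lemma cosint_deriv: "(cosint m has_real_derivative cos (real_of_int m * t)) (at t)"
  unfolding cosint_def by (cases "m = 0") (auto intro!: derivative_eq_intros)

lemma cosint_minus [simp]: "cosint m (- t) = - cosint m t"
  by (simp add: cosint_def)

text \<open>Only m mod 4 matters, since raising m by 4 adds 6 pi to the argument.\<close>

lemma sin_3pi_half: "sin (real_of_int m * (3 * pi / 2)) = (if even m then 0 else if m mod 4 = 1 then -1 else 1)"
proof -
  define q where "q = m div 4"
  have m: "m = 4 * q + m mod 4" and r: "m mod 4 \<in> {0, 1, 2, 3}"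
    unfolding q_def by auto
  have "sin (real_of_int m * (3 * pi / 2)) = sin (real_of_int (m mod 4) * (3 * pi / 2) + real_of_int (3 * q) * (2 * pi))"
    by (subst m) (simp add: algebra_simps)
  also have "\<dots> = sin (real_of_int (m mod 4) * (3 * pi / 2))"
    using sin.plus_of_int[of "real_of_int (m mod 4) * (3 * pi / 2)" "3 * q"] by simp
  finally have *: "sin (real_of_int m * (3 * pi / 2)) = sin (real_of_int (m mod 4) * (3 * pi / 2))" .
  have "sin (3 * pi) = 0" "sin (9 * pi / 2) = 1" "sin (3 * pi / 2) = -1"
    using sin_npi[of 3] sin.plus_of_int[of "pi/2" 2] sin_3over2_pi by (simp_all add: algebra_simps)
  moreover have "even m \<longleftrightarrow> m mod 4 \<in> {0, 2}" using r by (subst m) auto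
  ultimately show ?thesis
    unfolding * using r by auto
qed

lemma cosint_3pi_half:
  "cosint m (3 * pi / 2) = (if m = 0 then 3 * pi / 2 else if even m then 0 else if m mod 4 = 1 then - 1 / m else 1 / m)"
  unfolding cosint_def sin_3pi_half by simp

definition trig_kernel :: "real \<Rightarrow> real" where
  "trig_kernel t = (\<Sum>j<11. kcoeff j * cos (real j * t))"

lemma trig_kernel_nonneg: "0 \<le> trig_kernel t"
proof -
  have "trig_kernel t = (\<Sum>j<11. kcoeff j * cheb_T j (cos t))"
    by (simp add: trig_kernel_def cheb_T_cos)
  also have "0 \<le> \<dots>"
    unfolding kernel_sos by (intro add_nonneg_nonneg mult_nonneg_nonneg) (simp_all add: abs_square_le_1)
  finally show ?thesis .
qed

lemma minorant_nonneg:
  assumes "\<bar>t\<bar> \<le> 3 * pi / 4"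
  shows "0 \<le> (\<Sum>j<11. pcoeff j * cos (real j * t))"
proof -
  have "cos (3 * pi / 4) \<le> cos \<bar>t\<bar>"
    using assms by (intro cos_monotone_0_pi_le) auto
  moreover have "cos (3 * pi / 4) = - (sqrt 2 / 2)"
    using cos_minus_pi[of "pi / 4"] cos_45 by (simp add: field_simps)
  moreover have "sqrt 2 \<le> 17 / 12"
    by (rule real_le_lsqrt) (simp_all add: power2_eq_square)
  ultimately have y: "0 \<le> 17 + 24 * cos t"
    by (simp add: cos_abs_real)
  have "(\<Sum>j<11. pcoeff j * cos (real j * t)) = (\<Sum>j<11. pcoeff j * cheb_T j (cos t))"
    by (simp add: cheb_T_cos)
  also have "0 \<le> \<dots>"
    unfolding minorant_sos using y by (intro add_nonneg_nonneg[OF mult_nonneg_nonneg mult_nonneg_nonneg] mult_nonneg_nonneg) auto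
  finally show ?thesis .
qed

text \<open>The multiple of pi is \<open>kcoeff 0\<close> times the length 3 pi. Nonzero even
  frequencies integrate to 0, and odd ones give the rational part.\<close>

lemma nn_integral_trig_kernel:
  "(\<integral>\<^sup>+t. ennreal (trig_kernel t) * indicator {- (3 * pi / 2)..3 * pi / 2} t \<partial>lborel) = ennreal (567 * pi / 2 - 88472 / 315)"
proof -
  let ?F = "\<lambda>t. \<Sum>j<11. kcoeff j * cosint (int j) t"
  have "(?F has_real_derivative trig_kernel t) (at t)" for t
    unfolding trig_kernel_def by (auto intro!: derivative_eq_intros cosint_deriv[THEN DERIV_cong] simp: mult_ac)
  then have "(\<integral>\<^sup>+t. ennreal (trig_kernel t) * indicator {- (3 * pi / 2)..3 * pi / 2} t \<partial>lborel) =
     ennreal (?F (3 * pi / 2) - ?F (- (3 * pi / 2)))"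
    by (intro nn_integral_FTC_Icc trig_kernel_nonneg) (auto simp: trig_kernel_def[abs_def] intro: DERIV_subset)
  also have "?F (3 * pi / 2) - ?F (- (3 * pi / 2)) = 567 * pi / 2 - 88472 / 315"
    unfolding sum_11 kcoeff_def cosint_minus by (simp add: cosint_3pi_half)
  finally show ?thesis .
qed

text \<open>The autocorrelation will have integral 1, so adding 140 to the kernel shifts their
  pairing by exactly 140, while it sharpens Cauchy-Schwarz. Product-to-sum formulas produce the
  frequencies i - j and i + j, hence the integer index of \<open>cosint\<close>.\<close>

lemma nn_integral_trig_kernel_square:
  "(\<integral>\<^sup>+t. ennreal ((trig_kernel t + 140)\<^sup>2) * indicator {- (3 * pi / 2)..3 * pi / 2} t \<partial>lborel)
    = ennreal (1652847 * pi / 8 - 242401563552 / 1616615)"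
proof -
  define k where "k j = kcoeff j + (if j = 0 then 140 else 0)" for j
  let ?F = "\<lambda>t. \<Sum>i<11. \<Sum>j<11. k i * k j / 2 * (cosint (int i - int j) t + cosint (int i + int j) t)"
  have k: "trig_kernel t + 140 = (\<Sum>j<11. k j * cos (real j * t))" for t
    by (simp add: trig_kernel_def k_def sum_11)
  have "(trig_kernel t + 140)\<^sup>2 = (\<Sum>i<11. \<Sum>j<11. k i * k j / 2 *
      (cos (of_int (int i - int j) * t) + cos (of_int (int i + int j) * t)))" for t
    unfolding k power2_eq_square sum_product
    by (intro sum.cong refl) (simp add: ring_distribs cos_diff cos_add)
  then have "(?F has_real_derivative (trig_kernel t + 140)\<^sup>2) (at t)" for t
    by (simp only:) (intro DERIV_sum DERIV_cmult DERIV_add cosint_deriv)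
  then have "(\<integral>\<^sup>+t. ennreal ((trig_kernel t + 140)\<^sup>2) * indicator {- (3 * pi / 2)..3 * pi / 2} t \<partial>lborel) =
     ennreal (?F (3 * pi / 2) - ?F (- (3 * pi / 2)))"
    by (intro nn_integral_FTC_Icc) (auto simp: trig_kernel_def[abs_def] intro: DERIV_subset)
  also have "?F (3 * pi / 2) - ?F (- (3 * pi / 2)) = 1652847 * pi / 8 - 242401563552 / 1616615"
    unfolding sum_11 k_def kcoeff_def cosint_minus by (simp add: cosint_3pi_half)
  finally show ?thesis .
qed

section \<open>Convolution and autocorrelation of nonnegative functions\<close>

definition nnconv :: "(real \<Rightarrow> ennreal) \<Rightarrow> (real \<Rightarrow> ennreal) \<Rightarrow> real \<Rightarrow> ennreal" where
  "nnconv f g x = (\<integral>\<^sup>+y. f y * g (x - y) \<partial>lborel)"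

definition nncorr :: "(real \<Rightarrow> ennreal) \<Rightarrow> real \<Rightarrow> ennreal" where
  "nncorr f z = (\<integral>\<^sup>+y. f y * f (y + z) \<partial>lborel)"

lemma measurable_nnconv [measurable]:
  assumes [measurable]: "f \<in> borel_measurable borel" "g \<in> borel_measurable borel"
  shows "nnconv f g \<in> borel_measurable borel"
  unfolding nnconv_def[abs_def] by measurable

lemma measurable_nncorr [measurable]:
  assumes [measurable]: "f \<in> borel_measurable borel"
  shows "nncorr f \<in> borel_measurable borel"
  unfolding nncorr_def[abs_def] by measurable

lemma nn_integral_translate:
  fixes f :: "real \<Rightarrow> ennreal"
  assumes "f \<in> borel_measurable borel"
  shows "(\<integral>\<^sup>+x. f (t + x) \<partial>lborel) = (\<integral>\<^sup>+x. f x \<partial>lborel)"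
  using nn_integral_real_affine[OF assms, of 1 t] by simp

text \<open>Tonelli and a translation. The choice k = 1 gives the mass, k = h (x - z) associativity,
  and k = \<open>trig_kernel\<close> the pairing with the kernel.\<close>

lemma nn_integral_nnconv:
  assumes [measurable]: "f \<in> borel_measurable borel" "g \<in> borel_measurable borel" "k \<in> borel_measurable borel"
  shows "(\<integral>\<^sup>+z. nnconv f g z * k z \<partial>lborel) = (\<integral>\<^sup>+y. f y * (\<integral>\<^sup>+x. g x * k (y + x) \<partial>lborel) \<partial>lborel)"
proof -
  have "(\<integral>\<^sup>+z. nnconv f g z * k z \<partial>lborel) = (\<integral>\<^sup>+z. \<integral>\<^sup>+y. f y * (g (z - y) * k z) \<partial>lborel \<partial>lborel)"
    by (simp add: nnconv_def nn_integral_multc flip: mult.assoc)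
  also have "\<dots> = (\<integral>\<^sup>+y. \<integral>\<^sup>+z. f y * (g (z - y) * k z) \<partial>lborel \<partial>lborel)"
    by (rule lborel_pair.Fubini') measurable
  also have "\<dots> = (\<integral>\<^sup>+y. f y * (\<integral>\<^sup>+z. g (z - y) * k z \<partial>lborel) \<partial>lborel)"
    by (simp add: nn_integral_cmult)
  also have "\<dots> = (\<integral>\<^sup>+y. f y * (\<integral>\<^sup>+x. g x * k (y + x) \<partial>lborel) \<partial>lborel)"
    using nn_integral_translate[of "\<lambda>z. g (z - y) * k z" y for y] by simp
  finally show ?thesis .
qed

lemma nnconv_assoc:
  assumes [measurable]: "f \<in> borel_measurable borel" "g \<in> borel_measurable borel" "h \<in> borel_measurable borel"
  shows "nnconv (nnconv f g) h = nnconv f (nnconv g h)"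
proof
  fix x
  have "nnconv (nnconv f g) h x = (\<integral>\<^sup>+y. f y * (\<integral>\<^sup>+z. g z * h (x - (y + z)) \<partial>lborel) \<partial>lborel)"
    using nn_integral_nnconv[of f g "\<lambda>z. h (x - z)"] by (simp add: nnconv_def)
  also have "\<dots> = nnconv f (nnconv g h) x"
    by (simp add: nnconv_def algebra_simps)
  finally show "nnconv (nnconv f g) h x = nnconv f (nnconv g h) x" .
qed

lemma nn_integral_nncorr:
  assumes [measurable]: "f \<in> borel_measurable borel" "k \<in> borel_measurable borel"
  shows "(\<integral>\<^sup>+z. nncorr f z * k z \<partial>lborel) = (\<integral>\<^sup>+y. f y * (\<integral>\<^sup>+x. f x * k (x - y) \<partial>lborel) \<partial>lborel)"
proof -
  have "(\<integral>\<^sup>+z. nncorr f z * k z \<partial>lborel) = (\<integral>\<^sup>+z. \<integral>\<^sup>+y. f y * (f (y + z) * k z) \<partial>lborel \<partial>lborel)"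
    by (simp add: nncorr_def nn_integral_multc flip: mult.assoc)
  also have "\<dots> = (\<integral>\<^sup>+y. \<integral>\<^sup>+z. f y * (f (y + z) * k z) \<partial>lborel \<partial>lborel)"
    by (rule lborel_pair.Fubini') measurable
  also have "\<dots> = (\<integral>\<^sup>+y. f y * (\<integral>\<^sup>+z. f (y + z) * k z \<partial>lborel) \<partial>lborel)"
    by (simp add: nn_integral_cmult)
  also have "\<dots> = (\<integral>\<^sup>+y. f y * (\<integral>\<^sup>+x. f x * k (x - y) \<partial>lborel) \<partial>lborel)"
    using nn_integral_translate[of "\<lambda>x. f x * k (x - y)" y for y] by simp
  finally show ?thesis .
qed

text \<open>Both sides integrate \<open>f(p) f(q) f(r) f(s)\<close> over \<open>q - p = s - r\<close>, which is \<open>q + r = s + p\<close>.\<close>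

lemma nn_integral_nncorr_square:
  assumes [measurable]: "f \<in> borel_measurable borel"
  shows "(\<integral>\<^sup>+z. nncorr f z * nncorr f z \<partial>lborel) = (\<integral>\<^sup>+z. nnconv f f z * nnconv f f z \<partial>lborel)"
proof -
  have swap: "(\<integral>\<^sup>+z. (\<integral>\<^sup>+y. p y z \<partial>lborel) * (\<integral>\<^sup>+y. p y z \<partial>lborel) \<partial>lborel) =
      (\<integral>\<^sup>+y. \<integral>\<^sup>+w. \<integral>\<^sup>+z. p y z * p w z \<partial>lborel \<partial>lborel \<partial>lborel)"
    if [measurable]: "case_prod p \<in> borel_measurable (borel \<Otimes>\<^sub>M borel)" for p :: "real \<Rightarrow> real \<Rightarrow> ennreal"
  proof -
    have "(\<integral>\<^sup>+z. (\<integral>\<^sup>+y. p y z \<partial>lborel) * (\<integral>\<^sup>+y. p y z \<partial>lborel) \<partial>lborel) =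
        (\<integral>\<^sup>+z. \<integral>\<^sup>+y. \<integral>\<^sup>+w. p y z * p w z \<partial>lborel \<partial>lborel \<partial>lborel)"
      by (simp add: nn_integral_multc nn_integral_cmult)
    also have "\<dots> = (\<integral>\<^sup>+y. \<integral>\<^sup>+z. \<integral>\<^sup>+w. p y z * p w z \<partial>lborel \<partial>lborel \<partial>lborel)"
      by (rule lborel_pair.Fubini') measurable
    also have "\<dots> = (\<integral>\<^sup>+y. \<integral>\<^sup>+w. \<integral>\<^sup>+z. p y z * p w z \<partial>lborel \<partial>lborel \<partial>lborel)"
      by (intro nn_integral_cong lborel_pair.Fubini') measurable
    finally show ?thesis .
  qed
  \<comment> \<open>Substitute s = y + w + z: then y + z = s - w and w + z = s - y, so the factors
    exchange partners.\<close>
  have "(\<integral>\<^sup>+z. (f y * f (y + z)) * (f w * f (w + z)) \<partial>lborel) = (\<integral>\<^sup>+s. (f y * f (s - y)) * (f w * f (s - w)) \<partial>lborel)" for y w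
    using nn_integral_translate[of "\<lambda>s. (f y * f (s - y)) * (f w * f (s - w))" "y + w"]
    by (simp add: mult_ac add_ac)
  then show ?thesis
    unfolding nncorr_def nnconv_def
    using swap[of "\<lambda>y z. f y * f (y + z)"] swap[of "\<lambda>y s. f y * f (s - y)"] by simp
qed

lemma nnconv_eq_0:
  assumes "\<And>y. R < \<bar>y\<bar> \<Longrightarrow> f y = 0" "2 * R < \<bar>z\<bar>"
  shows "nnconv f f z = 0"
proof -
  have "(\<lambda>y. f y * f (z - y)) = (\<lambda>_. 0)"
  proof
    fix y show "f y * f (z - y) = 0"
    using assms(1)[of y] assms(1)[of "z - y"] assms(2) by (cases "R < \<bar>y\<bar>") auto
  qed
  then show ?thesis unfolding nnconv_def by simp
qed

lemma nncorr_eq_0: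
  assumes "\<And>y. R < \<bar>y\<bar> \<Longrightarrow> f y = 0" "2 * R < \<bar>z\<bar>"
  shows "nncorr f z = 0"
proof -
  have "(\<lambda>y. f y * f (y + z)) = (\<lambda>_. 0)"
  proof
    fix y show "f y * f (y + z) = 0"
    using assms(1)[of y] assms(1)[of "y + z"] assms(2) by (cases "R < \<bar>y\<bar>") auto
  qed
  then show ?thesis unfolding nncorr_def by simp
qed

section \<open>The twofold autoconvolution\<close>

text \<open>The scaling \<open>1/271\<close> of the minorant is close to the optimal \<open>-p\<^sub>0 / \<Sum>\<^bsub>j\<ge>1\<^esub> p\<^sub>j\<^sup>2 / c\<^sub>j\<close>.\<close>

lemma trig_coefficient_bound:
  fixes a :: "nat \<Rightarrow> real"
  assumes "a 0 = 1" "0 \<le> (\<Sum>j<11. pcoeff j * a j)"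
  shows "2009 / 10 \<le> 2 * (\<Sum>j<11. kcoeff j * (a j)\<^sup>2)"
proof -
  \<comment> \<open>Completing the square in x. It is used for j = 1, ..., 10 only: the term j = 0
    is exact, and the assumption bounds the sum of the remaining \<open>pcoeff j * a j\<close> below
    by \<open>- pcoeff 0\<close>.\<close>
  have "2 / 271 * (p * x) - p\<^sup>2 / (271\<^sup>2 * k) \<le> k * x\<^sup>2" if "0 < k" for k p x :: real
  proof -
    have "0 \<le> k * (x - p / (271 * k))\<^sup>2" using that by simp
    also have "\<dots> = k * x\<^sup>2 - (2 / 271 * (p * x) - p\<^sup>2 / (271\<^sup>2 * k))"
      using that by (simp add: power2_diff power_divide power_mult_distrib field_simps power2_eq_square)
    finally show ?thesis by simp
  qed
  note * = this[of "kcoeff j" "pcoeff j" "a j" for j]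
  show ?thesis
    using *[of 1] *[of 2] *[of 3] *[of 4] *[of 5] *[of 6] *[of 7] *[of 8] *[of 9] *[of 10] assms
    unfolding sum_11 by (simp add: kcoeff_def pcoeff_def power_divide)
qed

text \<open>The normalised case: the support has length 3 pi / 2, so the constant is 0.631 divided
  by that length.\<close>

lemma autoconvolution_not_le:
  fixes f :: "real \<Rightarrow> ennreal"
  assumes f [measurable]: "f \<in> borel_measurable borel"
    and one: "(\<integral>\<^sup>+x. f x \<partial>lborel) = 1"
    and supp: "\<And>x. 3 * pi / 4 < \<bar>x\<bar> \<Longrightarrow> f x = 0"
  shows "\<not> (AE z in lborel. nnconv f f z \<le> ennreal (2 * 0.631 / (3 * pi)))"
proof
  define M where "M = 2 * 0.631 / (3 * pi)"
  assume "AE z in lborel. nnconv f f z \<le> ennreal (2 * 0.631 / (3 * pi))"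
  then have le: "AE z in lborel. nnconv f f z \<le> ennreal M"
    by (simp add: M_def)
  have M: "0 \<le> M" by (simp add: M_def)
  let ?T = "{- (3 * pi / 2)..3 * pi / 2}"
  define \<mu> where "\<mu> = density lborel f"
  have sets [measurable_cong, simp]: "sets \<mu> = sets borel" and space [simp]: "space \<mu> = UNIV"
    by (simp_all add: \<mu>_def)
  interpret prob_space \<mu>
    by rule (simp add: \<mu>_def emeasure_density one)
  have trig_meas [measurable]: "trig_kernel \<in> borel_measurable borel"
    by (simp add: trig_kernel_def[abs_def])
  have [simp]: "integrable \<mu> (\<lambda>x. cos (c * x))" "integrable \<mu> (\<lambda>x. sin (c * x))" for c
    by (rule integrable_const_bound[where B=1]; simp)+
  define a where "a j = (LINT x|\<mu>. cos (real j * x))" for j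
  define b where "b j = (LINT x|\<mu>. sin (real j * x))" for j
  have nn_dens: "(\<integral>\<^sup>+y. f y * (\<integral>\<^sup>+x. f x * ennreal (g x y) \<partial>lborel) \<partial>lborel)
      = (\<integral>\<^sup>+y. (\<integral>\<^sup>+x. ennreal (g x y) \<partial>\<mu>) \<partial>\<mu>)"
    if [measurable]: "case_prod g \<in> borel_measurable (borel \<Otimes>\<^sub>M borel)" for g :: "real \<Rightarrow> real \<Rightarrow> real"
    unfolding \<mu>_def by (simp add: nn_integral_density)
  \<comment> \<open>The sign s = 1 serves the convolution and s = -1 the autocorrelation; the
    addition formula separates x from y.\<close>
  have iter: "(\<integral>\<^sup>+y. (\<integral>\<^sup>+x. ennreal (trig_kernel (x + s * y)) \<partial>\<mu>) \<partial>\<mu>)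
      = ennreal (\<Sum>j<11. kcoeff j * ((a j)\<^sup>2 - s * (b j)\<^sup>2))"
    and iter_nonneg: "0 \<le> (\<Sum>j<11. kcoeff j * ((a j)\<^sup>2 - s * (b j)\<^sup>2))"
    if "s = 1 \<or> s = -1" for s :: real
  proof -
    have expand: "trig_kernel (x + s * y) = (\<Sum>j<11. kcoeff j *
        (cos (real j * x) * cos (real j * y) - s * (sin (real j * x) * sin (real j * y))))" for x y
      using that by (auto simp: trig_kernel_def distrib_left right_diff_distrib cos_add cos_diff)
    have int1: "integrable \<mu> (\<lambda>x. trig_kernel (x + s * y))" for y
      unfolding expand by simp
    have inner: "(LINT x|\<mu>. trig_kernel (x + s * y)) = (\<Sum>j<11. kcoeff j *
        (a j * cos (real j * y) - s * (b j * sin (real j * y))))" for y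
      unfolding expand by (simp add: a_def b_def)
    have "0 \<le> (LINT x|\<mu>. trig_kernel (x + s * y))" for y
      by (simp add: trig_kernel_nonneg)
    then have nonneg: "0 \<le> (\<Sum>j<11. kcoeff j * (a j * cos (real j * y) - s * (b j * sin (real j * y))))" for y
      by (simp add: inner)
    have int2: "integrable \<mu> (\<lambda>y. (\<Sum>j<11. kcoeff j * (a j * cos (real j * y) - s * (b j * sin (real j * y)))))"
      by simp
    have outer: "(LINT y|\<mu>. (\<Sum>j<11. kcoeff j * (a j * cos (real j * y) - s * (b j * sin (real j * y)))))
        = (\<Sum>j<11. kcoeff j * ((a j)\<^sup>2 - s * (b j)\<^sup>2))"
      by (simp add: a_def[symmetric] b_def[symmetric] power2_eq_square)
    have "(\<integral>\<^sup>+x. ennreal (trig_kernel (x + s * y)) \<partial>\<mu>) =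
        ennreal (\<Sum>j<11. kcoeff j * (a j * cos (real j * y) - s * (b j * sin (real j * y))))" for y
      using nn_integral_eq_integral[OF int1] by (simp add: trig_kernel_nonneg inner)
    then show "(\<integral>\<^sup>+y. (\<integral>\<^sup>+x. ennreal (trig_kernel (x + s * y)) \<partial>\<mu>) \<partial>\<mu>)
      = ennreal (\<Sum>j<11. kcoeff j * ((a j)\<^sup>2 - s * (b j)\<^sup>2))"
      using nn_integral_eq_integral[OF int2] nonneg outer by simp
    show "0 \<le> (\<Sum>j<11. kcoeff j * ((a j)\<^sup>2 - s * (b j)\<^sup>2))"
      unfolding outer[symmetric] by (rule Bochner_Integration.integral_nonneg) (rule nonneg)
  qed
  \<comment> \<open>In X + Y the sine coefficients cancel.\<close>
  define X where "X = (\<Sum>j<11. kcoeff j * ((a j)\<^sup>2 - (b j)\<^sup>2))"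
  define Y where "Y = (\<Sum>j<11. kcoeff j * ((a j)\<^sup>2 + (b j)\<^sup>2))"
  have nonneg: "0 \<le> X" "0 \<le> Y"
    using iter_nonneg[of 1] iter_nonneg[of "-1"] by (simp_all add: X_def Y_def)
  have conv: "(\<integral>\<^sup>+z. nnconv f f z * ennreal (trig_kernel z) \<partial>lborel) = ennreal X"
    using nn_dens[of "\<lambda>x y. trig_kernel (x + 1 * y)"] iter[of 1]
    by (simp add: nn_integral_nnconv X_def add.commute)
  have corr: "(\<integral>\<^sup>+z. nncorr f z * ennreal (trig_kernel z) \<partial>lborel) = ennreal Y"
    using nn_dens[of "\<lambda>x y. trig_kernel (x + (-1) * y)"] iter[of "-1"]
    by (simp add: nn_integral_nncorr Y_def)
  have corr_1: "(\<integral>\<^sup>+z. nncorr f z \<partial>lborel) = 1"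
    using nn_integral_nncorr[of f "\<lambda>_. 1"] by (simp add: one)
  have conv_1: "(\<integral>\<^sup>+z. nnconv f f z \<partial>lborel) = 1"
    using nn_integral_nnconv[of f f "\<lambda>_. 1"] by (simp add: one)

  have "ennreal X \<le> (\<integral>\<^sup>+z. ennreal M * (ennreal (trig_kernel z) * indicator ?T z) \<partial>lborel)"
    unfolding conv[symmetric]
  proof (rule nn_integral_mono_AE)
    show "AE z in lborel. nnconv f f z * ennreal (trig_kernel z) \<le> ennreal M * (ennreal (trig_kernel z) * indicator ?T z)"
      using le
    proof eventually_elim
      case (elim z)
      show ?case
      proof (cases "z \<in> ?T")
        case True
        then show ?thesis using elim by (simp add: mult_right_mono)
      next
        case False
        then have "nnconv f f z = 0"
          by (intro nnconv_eq_0[where R = "3 * pi / 4"] supp) auto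
        then show ?thesis by simp
      qed
    qed
  qed
  also have "\<dots> = ennreal (M * (567 * pi / 2 - 88472 / 315))"
    by (simp add: nn_integral_cmult nn_integral_trig_kernel M flip: ennreal_mult')
  finally have X: "X \<le> M * (567 * pi / 2 - 88472 / 315)"
    using M pi_gt3 by (subst (asm) ennreal_le_iff) auto

  \<comment> \<open>Cauchy-Schwarz in the form \<open>2 \<alpha> D (K + 140) \<le> \<alpha>\<^sup>2 D\<^sup>2 + (K + 140)\<^sup>2\<close> on \<open>?T\<close>; the constants \<open>\<alpha> = 615 \<pi>\<close>
    and \<open>140\<close> are the nearly optimal ones.\<close>
  have "ennreal (1230 * pi) * ennreal (Y + 140) =
      (\<integral>\<^sup>+z. ennreal (1230 * pi) * (nncorr f z * ennreal (trig_kernel z + 140)) \<partial>lborel)"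
    using nonneg by (simp add: nn_integral_cmult nn_integral_add distrib_left trig_kernel_nonneg corr
        nn_integral_multc corr_1)
  also have "\<dots> \<le> (\<integral>\<^sup>+z. ennreal ((615 * pi)\<^sup>2) * (nncorr f z * nncorr f z) +
      ennreal ((trig_kernel z + 140)\<^sup>2) * indicator ?T z \<partial>lborel)"
  proof (rule nn_integral_mono)
    fix z
    show "ennreal (1230 * pi) * (nncorr f z * ennreal (trig_kernel z + 140)) \<le>
        ennreal ((615 * pi)\<^sup>2) * (nncorr f z * nncorr f z) + ennreal ((trig_kernel z + 140)\<^sup>2) * indicator ?T z"
    proof (cases "nncorr f z")
      case top
      then show ?thesis by (simp add: ennreal_mult_top)
    next
      case (real d)
      show ?thesis
      proof (cases "z \<in> ?T")
        case True
        have "0 \<le> (615 * pi * d - (trig_kernel z + 140))\<^sup>2" by simp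
        then have "1230 * pi * (d * (trig_kernel z + 140)) \<le> (615 * pi)\<^sup>2 * (d * d) + (trig_kernel z + 140)\<^sup>2"
          by (simp add: power2_eq_square algebra_simps)
        then show ?thesis
          using True real trig_kernel_nonneg[of z]
          by (simp add: ennreal_mult'[symmetric] ennreal_plus[symmetric] del: ennreal_plus)
      next
        case False
        then have "nncorr f z = 0"
          by (intro nncorr_eq_0[where R = "3 * pi / 4"] supp) auto
        then show ?thesis by simp
      qed
    qed
  qed
  also have "\<dots> = ennreal ((615 * pi)\<^sup>2) * (\<integral>\<^sup>+z. nnconv f f z * nnconv f f z \<partial>lborel)
      + ennreal (1652847 * pi / 8 - 242401563552 / 1616615)"
    by (simp add: nn_integral_add nn_integral_cmult nn_integral_nncorr_square nn_integral_trig_kernel_square)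
  also have "(\<integral>\<^sup>+z. nnconv f f z * nnconv f f z \<partial>lborel) \<le> (\<integral>\<^sup>+z. ennreal M * nnconv f f z \<partial>lborel)"
    using le by (intro nn_integral_mono_AE) (auto elim!: eventually_mono intro: mult_right_mono)
  also have "\<dots> = ennreal M"
    by (simp add: nn_integral_cmult conv_1)
  finally have "ennreal (1230 * pi) * ennreal (Y + 140) \<le> ennreal ((615 * pi)\<^sup>2) * ennreal M
      + ennreal (1652847 * pi / 8 - 242401563552 / 1616615)"
    by (simp add: mult_left_mono)
  also have "ennreal (1230 * pi) * ennreal (Y + 140) = ennreal (1230 * pi * (Y + 140))"
    using nonneg by (intro ennreal_mult[symmetric]) auto
  also have "ennreal ((615 * pi)\<^sup>2) * ennreal M + ennreal (1652847 * pi / 8 - 242401563552 / 1616615)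
      = ennreal ((615 * pi)\<^sup>2 * M + (1652847 * pi / 8 - 242401563552 / 1616615))"
    using M pi_gt3 by (subst ennreal_plus) (auto intro!: ennreal_mult[symmetric] simp del: power_mult_distrib)
  finally have Y: "1230 * pi * (Y + 140) \<le> (615 * pi)\<^sup>2 * M + (1652847 * pi / 8 - 242401563552 / 1616615)"
    using M pi_gt3 by (subst (asm) ennreal_le_iff) auto

  have "0 \<le> (LINT x|\<mu>. (\<Sum>j<11. pcoeff j * cos (real j * x)))"
  proof (rule integral_nonneg_AE)
    have "AE x in \<mu>. \<bar>x\<bar> \<le> 3 * pi / 4"
      unfolding \<mu>_def by (subst AE_density) (use supp in \<open>auto intro!: AE_I2 simp: not_less[symmetric]\<close>)
    then show "AE x in \<mu>. 0 \<le> (\<Sum>j<11. pcoeff j * cos (real j * x))"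
      by eventually_elim (rule minorant_nonneg)
  qed
  then have "0 \<le> (\<Sum>j<11. pcoeff j * a j)"
    by (simp add: a_def)
  moreover have "a 0 = 1"
    using prob_space by (simp add: a_def)
  ultimately have "2009 / 10 \<le> 2 * (\<Sum>j<11. kcoeff j * (a j)\<^sup>2)"
    by (intro trig_coefficient_bound)
  also have "\<dots> = X + Y"
    by (simp add: X_def Y_def algebra_simps sum.distrib sum_subtractf flip: sum_distrib_left)
  finally have XY: "2009 / 10 \<le> X + Y" .

  \<comment> \<open>Since \<open>pi * M\<close> is rational, multiplying by pi makes every estimate
    linear in pi, \<open>pi * X\<close> and \<open>pi * Y\<close>, so decimal bounds on pi finish
    the proof.\<close>
  have piM: "pi * M = 1262 / 3000"
    by (simp add: M_def)
  have "pi * X \<le> pi * (M * (567 * pi / 2 - 88472 / 315))"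
    using X by (intro mult_left_mono) simp_all
  also have "\<dots> = (pi * M) * (567 * pi / 2 - 88472 / 315)"
    by simp
  finally have "pi * X \<le> 1262 / 3000 * (567 * pi / 2 - 88472 / 315)"
    unfolding piM .
  moreover have "1230 * (pi * Y) \<le> 615\<^sup>2 * (1262 / 3000) * pi + (1652847 * pi / 8 - 242401563552 / 1616615) - 172200 * pi"
    using Y unfolding piM[symmetric] by (simp add: power2_eq_square algebra_simps)
  moreover have "2009 / 10 * pi \<le> pi * X + pi * Y"
    using mult_left_mono[OF XY, of pi] by (simp add: distrib_left)
  ultimately show False
    using pi_approx by simp
qed

section \<open>Rescaling and iterated autoconvolutions\<close>

lemma nnconv_self_not_le:
  fixes G :: "real \<Rightarrow> ennreal"
  assumes G [measurable]: "G \<in> borel_measurable borel"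
    and int: "(\<integral>\<^sup>+x. G x \<partial>lborel) = ennreal s" and pos: "0 < s" "0 < J"
    and supp: "\<And>x. x \<notin> {A..A + J} \<Longrightarrow> G x = 0"
  shows "\<not> (AE z in lborel. nnconv G G z \<le> ennreal (0.631 / J * s\<^sup>2))"
proof
  assume le: "AE z in lborel. nnconv G G z \<le> ennreal (0.631 / J * s\<^sup>2)"
  \<comment> \<open>The map x to c + l x carries [-3 pi / 4, 3 pi / 4] onto [A, A + J], and the
    factor l / s normalises the mass to 1.\<close>
  define l where "l = 2 * J / (3 * pi)"
  define c where "c = A + J / 2"
  define f where "f x = ennreal (l / s) * G (c + l * x)" for x
  have l: "0 < l" using pos by (simp add: l_def)
  have f_meas [measurable]: "f \<in> borel_measurable borel"
    unfolding f_def[abs_def] by measurable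
  have "(\<integral>\<^sup>+x. f x \<partial>lborel) = ennreal (1 / s) * (ennreal \<bar>l\<bar> * (\<integral>\<^sup>+x. G (c + l * x) \<partial>lborel))"
    using pos l by (simp add: f_def nn_integral_cmult ennreal_mult'[symmetric] flip: mult.assoc)
  also have "ennreal \<bar>l\<bar> * (\<integral>\<^sup>+x. G (c + l * x) \<partial>lborel) = ennreal s"
    unfolding int[symmetric] using l by (intro nn_integral_real_affine[symmetric]) auto
  also have "ennreal (1 / s) * ennreal s = 1"
    using pos by (simp flip: ennreal_mult')
  finally have f_int: "(\<integral>\<^sup>+x. f x \<partial>lborel) = 1" .
  have f_supp: "f x = 0" if "3 * pi / 4 < \<bar>x\<bar>" for x
  proof -
    have "J / 2 = l * (3 * pi / 4)" by (simp add: l_def)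
    also have "\<dots> < l * \<bar>x\<bar>" using that l by (intro mult_strict_left_mono)
    finally have "J / 2 < \<bar>l * x\<bar>" using l by (simp add: abs_mult)
    then have "c + l * x \<notin> {A..A + J}" by (auto simp: c_def)
    then show ?thesis by (simp add: f_def supp)
  qed
  have f_conv: "nnconv f f z = ennreal (l / s\<^sup>2) * nnconv G G (2 * c + l * z)" for z
  proof -
    have "nnconv f f z = (\<integral>\<^sup>+y. ennreal (l / s) * (ennreal (l / s) *
        (G (c + l * y) * G (2 * c + l * z - (c + l * y)))) \<partial>lborel)"
      by (simp add: nnconv_def f_def algebra_simps)
    also have "\<dots> = ennreal (l / s) * ennreal (l / s) *
        (\<integral>\<^sup>+y. G (c + l * y) * G (2 * c + l * z - (c + l * y)) \<partial>lborel)"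
      by (simp add: nn_integral_cmult mult.assoc)
    also have "ennreal (l / s) * ennreal (l / s) = ennreal (l / s\<^sup>2) * ennreal \<bar>l\<bar>"
      using pos l by (simp add: power2_eq_square flip: ennreal_mult')
    also have "ennreal (l / s\<^sup>2) * ennreal \<bar>l\<bar> * (\<integral>\<^sup>+y. G (c + l * y) * G (2 * c + l * z - (c + l * y)) \<partial>lborel)
        = ennreal (l / s\<^sup>2) * (ennreal \<bar>l\<bar> * (\<integral>\<^sup>+y. G (c + l * y) * G (2 * c + l * z - (c + l * y)) \<partial>lborel))"
      by (rule mult.assoc)
    also have "\<dots> = ennreal (l / s\<^sup>2) * nnconv G G (2 * c + l * z)"
      using l nn_integral_real_affine[of "\<lambda>y. G y * G (2 * c + l * z - y)" l c]
      unfolding nnconv_def by simp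
    finally show ?thesis .
  qed
  have "AE z in lborel. nnconv G G (2 * c + l * z) \<le> ennreal (0.631 / J * s\<^sup>2)"
    using l le by (intro AE_borel_affine) auto
  then have "AE z in lborel. nnconv f f z \<le> ennreal (2 * 0.631 / (3 * pi))"
  proof eventually_elim
    case (elim z)
    have "nnconv f f z \<le> ennreal (l / s\<^sup>2) * ennreal (0.631 / J * s\<^sup>2)"
      unfolding f_conv using elim by (rule mult_left_mono) simp
    also have "\<dots> = ennreal (l / s\<^sup>2 * (0.631 / J * s\<^sup>2))"
      using l by (intro ennreal_mult'[symmetric]) simp
    also have "l / s\<^sup>2 * (0.631 / J * s\<^sup>2) = 2 * 0.631 / (3 * pi)"
      using pos by (simp add: l_def)
    finally show ?case .
  qed
  with autoconvolution_not_le[OF f_meas f_int f_supp] show False by blast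
qed

text \<open>Note the shift: \<open>nnpow n g\<close> is the \<open>(n + 1)\<close>-fold autoconvolution of \<open>g\<close>.\<close>

primrec nnpow :: "nat \<Rightarrow> (real \<Rightarrow> ennreal) \<Rightarrow> real \<Rightarrow> ennreal" where
  "nnpow 0 g = g"
| "nnpow (Suc n) g = nnconv (nnpow n g) g"

lemma measurable_nnpow [measurable]:
  "g \<in> borel_measurable borel \<Longrightarrow> nnpow n g \<in> borel_measurable borel"
  by (induction n) auto

text \<open>The case m = n writes an even-fold autoconvolution as G * G; m + 1 and n + 1 factors
  together have index m + n + 1.\<close>

lemma nnpow_add:
  assumes [measurable]: "g \<in> borel_measurable borel"
  shows "nnpow (Suc (m + n)) g = nnconv (nnpow m g) (nnpow n g)"
  by (induction n) (simp_all add: nnconv_assoc)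

lemma nn_integral_nnpow:
  assumes [measurable]: "g \<in> borel_measurable borel"
  shows "(\<integral>\<^sup>+x. nnpow n g x \<partial>lborel) = (\<integral>\<^sup>+x. g x \<partial>lborel) ^ Suc n"
proof (induction n)
  case (Suc n)
  then show ?case
    using nn_integral_nnconv[of "nnpow n g" g "\<lambda>_. 1"] by (simp add: nn_integral_multc nn_integral_cmult mult_ac)
qed simp

lemma nnpow_eq_0:
  assumes "\<And>x. x \<notin> {a..a + I} \<Longrightarrow> g x = 0" "x \<notin> {real (Suc n) * a..real (Suc n) * a + real (Suc n) * I}"
  shows "nnpow n g x = 0"
  using assms(2)
proof (induction n arbitrary: x)
  case 0
  then show ?case using assms(1)[of x] by simp
next
  case (Suc n)
  have "nnpow n g y * g (x - y) = 0" for y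
  proof (cases "x - y \<in> {a..a + I}")
    case True
    then have "y \<notin> {real (Suc n) * a..real (Suc n) * a + real (Suc n) * I}"
      using Suc.prems by (auto simp: algebra_simps)
    then show ?thesis using Suc.IH by simp
  qed (use assms(1) in simp)
  then have "(\<lambda>y. nnpow n g y * g (x - y)) = (\<lambda>_. 0)" by blast
  then show ?case unfolding nnpow.simps nnconv_def by simp
qed

section \<open>Lebesgue-measurable functions and their Borel representatives\<close>

lemma AE_lborel_reflect:
  fixes P :: "real \<Rightarrow> bool"
  assumes "AE y in lborel. P y"
  shows "AE y in lborel. P (x - y)"
proof -
  obtain N where N: "N \<in> null_sets lborel" "{y. \<not> P y} \<subseteq> N"
    using assms by (auto simp: eventually_ae_filter)
  then have [measurable]: "N \<in> sets borel" by auto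
  have "AE y in lborel. y \<notin> N" using N(1) by (rule AE_not_in)
  then have "AE y in lborel. x + (-1) * y \<notin> N"
    by (intro AE_borel_affine) auto
  then show ?thesis
    by eventually_elim (use N(2) in auto)
qed

text \<open>A convolution depends only on the a.e. classes of its factors. Finite mass keeps every
  \<open>nnpow n g\<close> finite a.e., so \<open>enn2real\<close> loses nothing inside the
  integral.\<close>

lemma autoconvolution_AE_eq:
  fixes f :: "real \<Rightarrow> real" and g :: "real \<Rightarrow> ennreal"
  assumes g [measurable]: "g \<in> borel_measurable borel"
    and fin: "(\<integral>\<^sup>+x. g x \<partial>lborel) < \<infinity>"
    and eq: "AE x in lborel. f x = enn2real (g x)"
  shows "AE x in lborel. autoconvolution (Suc n) f x = enn2real (nnpow n g x)"
proof (induction n)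
  case 0
  then show ?case using eq by simp
next
  case (Suc n)
  have "autoconvolution (Suc (Suc n)) f x = enn2real (nnpow (Suc n) g x)" for x
  proof -
    have "(\<integral>\<^sup>+x. nnpow n g x \<partial>lborel) \<noteq> \<infinity>"
      using fin by (auto simp: nn_integral_nnpow ennreal_mult_eq_top_iff power_eq_top_ennreal simp del: power_Suc)
    then have finite: "AE y in lborel. nnpow n g y \<noteq> \<infinity>"
      by (intro nn_integral_PInf_AE) auto
    have "(\<integral>\<^sup>+x. g x \<partial>lborel) \<noteq> \<infinity>" using fin by simp
    then have "AE y in lborel. g y \<noteq> \<infinity>"
      by (intro nn_integral_PInf_AE) auto
    then have finite': "AE y in lborel. g (x - y) \<noteq> \<infinity>"
      by (rule AE_lborel_reflect)
    have ae: "AE y in lborel. enn2real (nnpow n g y * g (x - y)) = autoconvolution (Suc n) f y * f (x - y)"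
      using Suc.IH AE_lborel_reflect[OF eq, of x] by eventually_elim (simp add: enn2real_mult)
    have meas: "(\<lambda>y. enn2real (nnpow n g y * g (x - y))) \<in> borel_measurable lborel"
      by measurable
    have "autoconvolution (Suc (Suc n)) f x = (LINT y|lebesgue. enn2real (nnpow n g y * g (x - y)))"
      unfolding autoconvolution.simps convolution_def
    proof (rule integral_cong_AE)
      show m: "(\<lambda>y. enn2real (nnpow n g y * g (x - y))) \<in> borel_measurable lebesgue"
        using meas by (rule measurable_completion)
      show "(\<lambda>y. autoconvolution (Suc n) f y * f (x - y)) \<in> borel_measurable lebesgue"
        using m AE_completion[OF ae] by (rule borel_measurable_AE)
      show "AE y in lebesgue. autoconvolution (Suc n) f y * f (x - y) = enn2real (nnpow n g y * g (x - y))"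
        using AE_completion[OF ae] by eventually_elim simp
    qed
    also have "\<dots> = (LINT y|lborel. enn2real (nnpow n g y * g (x - y)))"
      by (rule integral_completion[OF meas])
    \<comment> \<open>This needs no integrability: if the integral is infinite, both sides are 0 by
      convention.\<close>
    also have "\<dots> = enn2real (\<integral>\<^sup>+y. ennreal (enn2real (nnpow n g y * g (x - y))) \<partial>lborel)"
      by (rule integral_eq_nn_integral) simp_all
    also have "(\<integral>\<^sup>+y. ennreal (enn2real (nnpow n g y * g (x - y))) \<partial>lborel) = nnpow (Suc n) g x"
      unfolding nnpow.simps nnconv_def
      using finite finite' by (intro nn_integral_cong_AE, eventually_elim)
        (simp add: ennreal_mult_less_top less_top)
    finally show ?thesis .
  qed
  then show ?case by simp
qed

text \<open>The zero function is excluded because both sides vanish for it, so that the strict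
  inequality fails.\<close>

theorem theorem1p1:
  fixes f :: "real \<Rightarrow> real" and a I :: real and h :: nat
  assumes L1: "integrable lebesgue f"
    and L2: "integrable lebesgue (\<lambda>x. (f x)\<^sup>2)"
    and nonneg: "AE x in lebesgue. 0 \<le> f x"
    and supp: "AE x in lebesgue. x \<notin> {a..a + I} \<longrightarrow> f x = 0"
    and nonzero: "\<not> (AE x in lebesgue. f x = 0)"
    and h: "even h" "0 < h"
  shows "Linf_norm (autoconvolution h f) > ereal (1.262 / (real h * I) * L1_norm f ^ h)"
proof (rule ccontr)
  assume "\<not> ?thesis"
  then have norm_le: "Linf_norm (autoconvolution h f) \<le> ereal (1.262 / (real h * I) * L1_norm f ^ h)"
    by simp
  obtain n where n: "h = 2 * Suc n"
    using h by (metis dvdE gr0_implies_Suc mult_0_right neq0_conv)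
  obtain f' where f' [measurable]: "f' \<in> borel_measurable lborel" and ff': "AE x in lborel. f x = f' x"
    using completion_ex_borel_measurable_real[of f lborel] L1 by auto
  \<comment> \<open>\<open>ennreal\<close> cuts off negative values, and the indicator makes g
    vanish at every point off the interval, as \<open>nnpow_eq_0\<close> requires.\<close>
  define g where "g x = ennreal (f' x) * indicator {a..a + I} x" for x
  have g [measurable]: "g \<in> borel_measurable borel"
    unfolding g_def[abs_def] using f' by measurable
  have fg: "AE x in lborel. f x = enn2real (g x)"
    using ff' nonneg supp unfolding AE_completion_iff
    by eventually_elim (auto simp: g_def indicator_def)
  define s where "s = L1_norm f"
  have int_g: "(\<integral>\<^sup>+x. g x \<partial>lborel) = ennreal s"
  proof -
    have "(\<integral>\<^sup>+x. g x \<partial>lborel) = (\<integral>\<^sup>+x. ennreal \<bar>f x\<bar> \<partial>lborel)"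
      by (intro nn_integral_cong_AE, use fg in eventually_elim) (simp add: g_def split: split_indicator)
    also have "\<dots> = (\<integral>\<^sup>+x. ennreal \<bar>f x\<bar> \<partial>lebesgue)"
      by (rule nn_integral_completion[symmetric])
    also have "\<dots> = ennreal s"
      unfolding s_def L1_norm_def using L1 by (intro nn_integral_eq_integral) auto
    finally show ?thesis .
  qed
  have "s \<noteq> 0"
  proof
    assume "s = 0"
    then have "AE x in lborel. g x = 0"
      using int_g nn_integral_0_iff_AE[of g lborel] by simp
    then have "AE x in lborel. f x = 0"
      using fg by eventually_elim simp
    with nonzero show False by (simp add: AE_completion_iff)
  qed
  moreover have "0 \<le> s"
    by (simp add: s_def L1_norm_def)
  ultimately have s: "0 < s" by simp
  \<comment> \<open>Otherwise the interval has at most one point and f = 0 a.e.\<close>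
  have I: "0 < I"
  proof (rule ccontr)
    assume "\<not> 0 < I"
    then have "{a..a + I} \<subseteq> {a}" by auto
    moreover have "AE x in lborel. x \<noteq> a" by (rule AE_lborel_singleton)
    then have "AE x in lebesgue. x \<noteq> a" by (rule AE_completion)
    then have "AE x in lebesgue. f x = 0"
      using supp by eventually_elim (use calculation in auto)
    with nonzero show False ..
  qed
  have pow: "autoconvolution h f = autoconvolution (Suc (Suc (n + n))) f"
    by (simp add: n mult_2)
  have fin: "(\<integral>\<^sup>+x. g x \<partial>lborel) < \<infinity>" by (simp add: int_g)
  have int_pow: "(\<integral>\<^sup>+x. nnpow m g x \<partial>lborel) = ennreal (s ^ Suc m)" for m
    using s by (simp add: nn_integral_nnpow int_g ennreal_power del: power_Suc)
  \<comment> \<open>Finiteness a.e. allows the bound on the \<open>enn2real\<close> value to be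
    lifted back to \<open>ennreal\<close>.\<close>
  have "AE x in lborel. nnpow (Suc (n + n)) g x \<noteq> \<infinity>"
    by (intro nn_integral_PInf_AE) (auto simp: int_pow simp del: nnpow.simps)
  moreover have "AE x in lborel. autoconvolution h f x = enn2real (nnpow (Suc (n + n)) g x)"
    unfolding pow by (rule autoconvolution_AE_eq[OF g fin fg])
  moreover have "AE x in lborel. ereal \<bar>autoconvolution h f x\<bar> \<le> Linf_norm (autoconvolution h f)"
    unfolding Linf_norm_def using esssup_AE[of "\<lambda>x. ereal \<bar>autoconvolution h f x\<bar>" lebesgue]
    by (simp add: AE_completion_iff)
  ultimately have "AE x in lborel. nnconv (nnpow n g) (nnpow n g) x \<le> ennreal (1.262 / (real h * I) * s ^ h)"
  proof eventually_elim
    case (elim x)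
    then have "enn2real (nnpow (Suc (n + n)) g x) \<le> 1.262 / (real h * I) * s ^ h"
      using order_trans[OF elim(3) norm_le] by (simp add: s_def)
    then have "ennreal (enn2real (nnpow (Suc (n + n)) g x)) \<le> ennreal (1.262 / (real h * I) * s ^ h)"
      by (rule ennreal_leI)
    moreover have "ennreal (enn2real (nnpow (Suc (n + n)) g x)) = nnpow (Suc (n + n)) g x"
      using elim(1) by (intro ennreal_enn2real) (simp only: less_top infinity_ennreal_def)
    ultimately show ?case
      by (simp only: nnpow_add[OF g])
  qed
  moreover have "1.262 / (real h * I) * s ^ h = 0.631 / (real (Suc n) * I) * (s ^ Suc n)\<^sup>2"
  proof -
    have "real h = 2 * real (Suc n)" "s ^ h = (s ^ Suc n)\<^sup>2"
      by (simp_all only: n power_mult[symmetric] mult.commute[of 2] of_nat_mult of_nat_numeral)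
    then show ?thesis
      by (simp del: power_Suc of_nat_Suc)
  qed
  ultimately have "AE x in lborel. nnconv (nnpow n g) (nnpow n g) x
      \<le> ennreal (0.631 / (real (Suc n) * I) * (s ^ Suc n)\<^sup>2)"
    by (simp only:)
  moreover have "nnpow n g x = 0" if "x \<notin> {real (Suc n) * a..real (Suc n) * a + real (Suc n) * I}" for x
    using that by (rule nnpow_eq_0[rotated]) (simp add: g_def)
  moreover have "0 < s ^ Suc n" "0 < real (Suc n) * I"
    using s I by (simp_all del: power_Suc of_nat_Suc)
  ultimately show False
    using nnconv_self_not_le[OF measurable_nnpow[OF g] int_pow] by blast
qed

end
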